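(* The following spaces are isometrically isomorphic for $1\leq p <\infty$: $G^{p}\cong \ell^{p}(\mathfrak c, L^{p}[0,1])$.
   Context: Let $\mathcal{B}$ be the Borel $\sigma$-algebra of $\mathbb{R}$, $\lambda$ the Lebesgue measure, and $\mathcal{B}_{\infty}$ the $\sigma$-algebra on $\mathbb{R}^{\mathbb{N}}$ generated by the cylinder sets $\prod_{i=1}^{m}C_{i}\times\prod_{i=m+1}^{\infty}\mathbb{R}$ with $C_i\in\mathcal{B}$, $m\in\mathbb{N}$. Let $\mathcal{F}(\mathcal{B},\lambda)$ be the set of finite rectangles $\prod_{i\in\mathbb{N}}C_{i}$ with $C_i\in\mathcal{B}$ and $\prod_{i}\lambda(C_i)\in[0,\infty)$, with $\mathrm{vol}(\prod_{i}C_i):=\prod_i\lambda(C_i)$. The measure $\mu$ is the restriction to $\mathcal{B}_{\infty}$ of the outer measure $\mu^{\ast}(A):=\inf\{\sum_{n}\mathrm{vol}(\mathscr{C}_{n}) : \mathscr{C}_{n}\in\mathcal{F}(\mathcal{B},\lambda),\ A\subset\bigcup_{n}\mathscr{C}_{n}\}$ ($\inf\varnothing=\infty$). Let $I:=\mathbb{Z}^{\mathbb{N}}$ and, for $\mathfrak{a}=(a_n)\in I$, $\mathcal{C}_{\mathfrak{a}}:=\prod_{n\in\mathbb{N}}[a_{n},a_{n}+1)$. For $f\in L^p(\mu)$ let $\mathcal{O}_{f}:=\{\mathfrak{a}\in I : \int_{\mathcal{C}_{\mathfrak{a}}}|f|^{p}\,d\mu\neq 0\}$ and $\mathcal{F}_{f}:=\bigsqcup_{\mathfrak{a}\in\mathcal{O}_{f}}\mathcal{C}_{\mathfrak{a}}$.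 Define $G^{p}:=\{f\in L^{p}(\mu) : \int_{\mathbb{R}^{\mathbb{N}}}|f|^{p}\,d\mu=\sum_{\mathfrak{a}\in\mathcal{O}_{f}}\int_{\mathcal{C}_{\mathfrak{a}}}|f|^{p}\,d\mu=\int_{\mathcal{F}_{f}}|f|^{p}\,d\mu\}$ (a linear subspace of $L^p(\mu)$ with the $L^p$ norm). $\ell^{p}(\kappa,X)$ denotes the $\ell^p$-sum of $\kappa$ copies of the Banach space $X$, and $\mathfrak{c}$ is the cardinality of the continuum. *)

theory Defs
  imports "HOL-Analysis.Analysis"
begin

definition cylinders :: "(nat \<Rightarrow> real) set set" where
  "cylinders = {A. \<exists>m (C :: nat \<Rightarrow> real set).
      (\<forall>i<m. C i \<in> sets borel) \<and> A = {x. \<forall>i<m. x i \<in> C i}}"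

definition B_inf :: "(nat \<Rightarrow> real) set set" where
  "B_inf = sigma_sets UNIV cylinders"

definition rect :: "(nat \<Rightarrow> real set) \<Rightarrow> (nat \<Rightarrow> real) set" where
  "rect C = {x. \<forall>i. x i \<in> C i}"

definition is_finite_rect :: "(nat \<Rightarrow> real set) \<Rightarrow> bool" where
  "is_finite_rect C \<longleftrightarrow> (\<forall>i. C i \<in> sets borel) \<and>
     (\<exists>v. ((\<lambda>n. \<Prod>i<n. emeasure lborel (C i)) \<longlonglongrightarrow> v) \<and> v < \<infinity>)"

definition vol :: "(nat \<Rightarrow> real set) \<Rightarrow> ennreal" where
  "vol C = lim (\<lambda>n. \<Prod>i<n. emeasure lborel (C i))"

definition mu_outer :: "(nat \<Rightarrow> real) set \<Rightarrow> ennreal" where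
  "mu_outer A = (INF Cs \<in> {Cs :: nat \<Rightarrow> nat \<Rightarrow> real set.
       (\<forall>n. is_finite_rect (Cs n)) \<and> A \<subseteq> (\<Union>n. rect (Cs n))}. \<Sum>n. vol (Cs n))"

definition mu :: "(nat \<Rightarrow> real) measure" where
  "mu = measure_of UNIV cylinders mu_outer"

definition unit_cube :: "(nat \<Rightarrow> int) \<Rightarrow> (nat \<Rightarrow> real) set" where
  "unit_cube a = {x. \<forall>n. of_int (a n) \<le> x n \<and> x n < of_int (a n) + 1}"

text \<open>Membership in L^p(mu) (representatives; real scalars).\<close>
definition Lp_mu :: "real \<Rightarrow> ((nat \<Rightarrow> real) \<Rightarrow> real) set" where
  "Lp_mu p = {f. f \<in> borel_measurable mu \<and>
                 (\<integral>\<^sup>+ x. ennreal (\<bar>f x\<bar> powr p) \<partial>mu) < \<infinity>}"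

definition O_set :: "real \<Rightarrow> ((nat \<Rightarrow> real) \<Rightarrow> real) \<Rightarrow> (nat \<Rightarrow> int) set" where
  "O_set p f = {a. (\<integral>\<^sup>+ x. indicator (unit_cube a) x * ennreal (\<bar>f x\<bar> powr p) \<partial>mu) \<noteq> 0}"

definition F_set :: "real \<Rightarrow> ((nat \<Rightarrow> real) \<Rightarrow> real) \<Rightarrow> (nat \<Rightarrow> real) set" where
  "F_set p f = (\<Union>a\<in>O_set p f. unit_cube a)"

definition Gp :: "real \<Rightarrow> ((nat \<Rightarrow> real) \<Rightarrow> real) set" where
  "Gp p = {f \<in> Lp_mu p.
     (\<integral>\<^sup>+ x. ennreal (\<bar>f x\<bar> powr p) \<partial>mu)
       = (\<Sum>\<^sub>\<infinity> a\<in>O_set p f. \<integral>\<^sup>+ x. indicator (unit_cube a) x * ennreal (\<bar>f x\<bar> powr p) \<partial>mu)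
   \<and> (\<integral>\<^sup>+ x. ennreal (\<bar>f x\<bar> powr p) \<partial>mu)
       = (\<integral>\<^sup>+ x. indicator (F_set p f) x * ennreal (\<bar>f x\<bar> powr p) \<partial>mu)}"

text \<open>Index set of cardinality continuum: UNIV :: real set.\<close>
definition lp_Lp01 :: "real \<Rightarrow> (real \<Rightarrow> real \<Rightarrow> real) set" where
  "lp_Lp01 p = {F. (\<forall>i. F i \<in> borel_measurable (lebesgue_on {0..1})) \<and>
     (\<Sum>\<^sub>\<infinity> i\<in>(UNIV::real set). \<integral>\<^sup>+ t. ennreal (\<bar>F i t\<bar> powr p) \<partial>(lebesgue_on {0..1})) < \<infinity>}"

definition lp_Lp01_normp :: "real \<Rightarrow> (real \<Rightarrow> real \<Rightarrow> real) \<Rightarrow> ennreal" where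
  "lp_Lp01_normp p F =
     (\<Sum>\<^sub>\<infinity> i\<in>(UNIV::real set). \<integral>\<^sup>+ t. ennreal (\<bar>F i t\<bar> powr p) \<partial>(lebesgue_on {0..1}))"

end

theory Submission
  imports Defs "HOL-Probability.Probability"
begin

text \<open>
  Every coordinate half-space splits a finite rectangle additively, so Caratheodory's theorem makes
  the outer measure a measure on the product \<open>\<sigma>\<close>-algebra. The law \<open>Q\<close> of a sequence of independent uniform
  variables on the sides of a unit cube satisfies \<open>Q \<le> mu\<close>, since \<open>Q\<close> of a rectangle is bounded by its
  volume. As \<open>mu\<close> of the cube is at most \<open>1\<close>, comparing a set and its complement in the cube gives
  \<open>Q = mu\<close> there. Distributing the binary digits of one real over countably many reals is an
  isomorphism modulo null sets from the unit interval to the cube. Composing with these isomorphisms,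
  one for each of the continuum many cubes, is the required isometry; it is onto because an element of
  the \<open>\<ell>\<^sup>p\<close>-sum has only countably many nonzero components.
\<close>

subsection \<open>The measure mu\<close>

lemma finite_rectE:
  assumes "is_finite_rect C"
  obtains v where "(\<lambda>n. \<Prod>i<n. emeasure lborel (C i)) \<longlonglongrightarrow> v" "v < \<infinity>" "vol C = v"
  using assms unfolding is_finite_rect_def vol_def by (auto dest: limI)

lemma finite_rect_borel: "is_finite_rect C \<Longrightarrow> C i \<in> sets borel"
  by (simp add: is_finite_rect_def)

lemma tendsto_vol:
  "is_finite_rect C \<Longrightarrow> (\<lambda>n. \<Prod>i<n. emeasure lborel (C i)) \<longlonglongrightarrow> vol C"
  by (erule finite_rectE) simp

lemma prod_emeasure_update:
  fixes C :: "nat \<Rightarrow> real set"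
  assumes "j < n"
  shows "(\<Prod>i<n. emeasure lborel ((C(j := B)) i)) =
    emeasure lborel B * (\<Prod>i\<in>{..<n} - {j}. emeasure lborel (C i))"
proof -
  have "(\<Prod>i<n. emeasure lborel ((C(j := B)) i)) =
    emeasure lborel ((C(j := B)) j) * (\<Prod>i\<in>{..<n} - {j}. emeasure lborel ((C(j := B)) i))"
    using assms by (intro prod.remove) auto
  also have "(\<Prod>i\<in>{..<n} - {j}. emeasure lborel ((C(j := B)) i)) = (\<Prod>i\<in>{..<n} - {j}. emeasure lborel (C i))"
    by (intro prod.cong) auto
  finally show ?thesis by simp
qed

text \<open>If the measure of \<open>C j\<close> is neither 0 nor infinite, the new partial products
  are eventually a constant finite multiple of the old ones, so they still converge. In the two
  degenerate cases they are eventually 0.\<close>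

lemma is_finite_rect_update:
  assumes C: "is_finite_rect C" and B: "B \<in> sets borel" "B \<subseteq> C j"
  shows "is_finite_rect (C(j := B))"
proof -
  define q where "q n = (\<Prod>i\<in>{..<n} - {j}. emeasure lborel (C i))" for n
  let ?P = "\<lambda>n. \<Prod>i<n. emeasure lborel (C i)"
  let ?P' = "\<lambda>n. \<Prod>i<n. emeasure lborel ((C(j := B)) i)"
  let ?m = "emeasure lborel (C j)"
  have P: "?P n = ?m * q n" if "j < n" for n
    using prod_emeasure_update[OF that, of C "C j"] by (simp add: q_def)
  have P': "?P' n = emeasure lborel B * q n" if "j < n" for n
    using prod_emeasure_update[OF that, of C B] by (simp add: q_def)
  have large: "eventually (\<lambda>n. j < n) sequentially"
    by (rule eventually_gt_at_top)
  have le: "emeasure lborel B \<le> ?m"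
    using B finite_rect_borel[OF C] by (intro emeasure_mono) auto
  obtain v where v: "?P \<longlonglongrightarrow> v" "v < \<infinity>"
    using C by (rule finite_rectE)
  have "\<exists>v'. ?P' \<longlonglongrightarrow> v' \<and> v' < \<infinity>"
  proof (cases "?m = 0 \<or> ?m = \<infinity>")
    case True
    have "eventually (\<lambda>n. 0 = ?P' n) sequentially"
    proof (cases "?m = 0")
      case True
      then have "emeasure lborel B = 0" using le by simp
      with P' show ?thesis by (intro eventually_mono[OF large]) (simp del: fun_upd_apply)
    next
      case False
      \<comment> \<open>An infinite factor leaves a finite product only if the remaining factors
        multiply to 0, and this then holds for the new product too.\<close>
      have "eventually (\<lambda>n. ?P n < \<infinity>) sequentially"
        using v by (rule order_tendstoD)
      with large show ?thesis
      proof eventually_elim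
        case (elim n)
        then have "q n = 0"
          using True False P[of n] by (auto simp: ennreal_top_mult split: if_splits)
        then show ?case using elim by (simp add: P' del: fun_upd_apply)
      qed
    qed
    then have "?P' \<longlonglongrightarrow> 0"
      by (rule Lim_transform_eventually[OF tendsto_const])
    then show ?thesis by (intro exI[of _ 0]) simp
  next
    case False
    let ?c = "emeasure lborel B / ?m"
    have "?c \<noteq> top"
      using False le by (auto simp: ennreal_divide_eq_top_iff top_unique)
    then have c: "?c < \<infinity>" by (simp add: less_top)
    have "eventually (\<lambda>n. ?c * ?P n = ?P' n) sequentially"
      using large
    proof eventually_elim
      case (elim n)
      have "?c * ?P n = (?c * ?m) * q n"
        using elim by (simp add: P mult.assoc)
      also have "?c * ?m = emeasure lborel B"
        using False by (simp add: ennreal_divide_times ennreal_times_divide[symmetric] less_top)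
      finally show ?case using elim by (simp add: P' del: fun_upd_apply)
    qed
    moreover have "(\<lambda>n. ?c * ?P n) \<longlonglongrightarrow> ?c * v"
      using c v by (intro ennreal_tendsto_cmult) auto
    ultimately have "?P' \<longlonglongrightarrow> ?c * v"
      by (rule Lim_transform_eventually[rotated])
    then show ?thesis using c v by (auto simp: ennreal_mult_less_top less_top)
  qed
  then show ?thesis
    using C B unfolding is_finite_rect_def by auto
qed

text \<open>As soon as \<open>n > j\<close>, the partial products split exactly by additivity of
  Lebesgue measure in coordinate \<open>j\<close>; the identity passes to the limit.\<close>

lemma vol_split:
  assumes C: "is_finite_rect C" and D: "D \<in> sets borel"
  shows "vol (C(j := C j \<inter> D)) + vol (C(j := C j - D)) = vol C"
proof -
  have meas: "C j \<in> sets borel" using C by (rule finite_rect_borel)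
  have fin: "is_finite_rect (C(j := C j \<inter> D))" "is_finite_rect (C(j := C j - D))"
    using is_finite_rect_update[OF C, of "C j \<inter> D"] is_finite_rect_update[OF C, of "C j - D"] meas D
    by auto
  have add: "emeasure lborel (C j \<inter> D) + emeasure lborel (C j - D) = emeasure lborel (C j)"
    using meas D by (subst plus_emeasure) (auto intro: arg_cong[where f="emeasure lborel"])
  have "eventually (\<lambda>n. (\<Prod>i<n. emeasure lborel ((C(j := C j \<inter> D)) i)) +
      (\<Prod>i<n. emeasure lborel ((C(j := C j - D)) i)) = (\<Prod>i<n. emeasure lborel (C i))) sequentially"
    using eventually_gt_at_top[of j]
  proof eventually_elim
    case (elim n)
    show ?case
      using prod_emeasure_update[OF elim, of C "C j"]
      by (simp add: prod_emeasure_update[OF elim] distrib_right[symmetric] add del: fun_upd_apply)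
  qed
  from Lim_transform_eventually[OF tendsto_add[OF tendsto_vol[OF fin(1)] tendsto_vol[OF fin(2)]] this]
  show ?thesis
    using tendsto_vol[OF C] LIMSEQ_unique by blast
qed

section \<open>The outer measure and its Caratheodory measurable sets\<close>

lemma mu_outer_le:
  assumes "\<And>n. is_finite_rect (Cs n)" "A \<subseteq> (\<Union>n. rect (Cs n))"
  shows "mu_outer A \<le> (\<Sum>n. vol (Cs n))"
  unfolding mu_outer_def using assms by (intro INF_lower) auto

lemma mu_outer_geI:
  assumes "\<And>Cs. (\<And>n. is_finite_rect (Cs n)) \<Longrightarrow> A \<subseteq> (\<Union>n. rect (Cs n)) \<Longrightarrow> z \<le> (\<Sum>n. vol (Cs n))"
  shows "z \<le> mu_outer A"
  unfolding mu_outer_def using assms by (intro INF_greatest) auto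

text \<open>Empty rectangles pad finite covers to the infinite sequences required by
  \<open>mu_outer\<close>.\<close>

lemma empty_rect: "is_finite_rect (\<lambda>_. {})" "vol (\<lambda>_. {}) = 0" "rect (\<lambda>_. {}) = {}"
proof -
  \<comment> \<open>The empty product at \<open>n = 0\<close> is 1, so the products vanish only from
    \<open>n = 1\<close> on.\<close>
  have "eventually (\<lambda>n. 0 = (\<Prod>i<n. emeasure lborel ({}::real set))) sequentially"
    using eventually_gt_at_top[of 0] by eventually_elim (auto simp: prod_zero_iff)
  then have lim: "(\<lambda>n. \<Prod>i<n. emeasure lborel ({}::real set)) \<longlonglongrightarrow> 0"
    by (rule Lim_transform_eventually[OF tendsto_const])
  then show "is_finite_rect (\<lambda>_. {})"
    unfolding is_finite_rect_def by (auto intro!: exI[of _ 0])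
  show "vol (\<lambda>_. {}) = 0"
    unfolding vol_def using lim by (rule limI)
qed (simp add: rect_def)

lemma mu_outer_empty: "mu_outer {} = 0"
  using mu_outer_le[of "\<lambda>_ _. {}" "{}"] by (simp add: empty_rect)

lemma mu_outer_mono: "A \<subseteq> B \<Longrightarrow> mu_outer A \<le> mu_outer B"
  by (rule mu_outer_geI) (auto intro!: mu_outer_le)

lemma mu_outer_countably_subadditive: "mu_outer (\<Union>n. A n) \<le> (\<Sum>n. mu_outer (A n))"
proof (rule ennreal_le_epsilon)
  fix e :: real assume "0 < e" "(\<Sum>n. mu_outer (A n)) < top"
  \<comment> \<open>A finite total makes each \<open>mu_outer (A n)\<close> finite, so adding a
    positive term is a strict increase and some cover has volume below it.\<close>
  then have *: "\<And>n. mu_outer (A n) < mu_outer (A n) + e * (1/2)^Suc n"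
    by (auto simp add: less_top dest!: ennreal_suminf_lessD)
  have "\<exists>Cs. (\<forall>k. is_finite_rect (Cs k)) \<and> A n \<subseteq> (\<Union>k. rect (Cs k)) \<and>
      (\<Sum>k. vol (Cs k)) \<le> mu_outer (A n) + e * (1/2)^Suc n" for n
    using *[of n] unfolding mu_outer_def[of "A n"] INF_less_iff by (auto intro: less_imp_le)
  then obtain Cs where Cs: "\<And>n k. is_finite_rect (Cs n k)" "\<And>n. A n \<subseteq> (\<Union>k. rect (Cs n k))"
      "\<And>n. (\<Sum>k. vol (Cs n k)) \<le> mu_outer (A n) + e * (1/2)^Suc n"
    by metis
  let ?D = "\<lambda>m. case_prod Cs (prod_decode m)"
  have "(\<Union>n. A n) \<subseteq> (\<Union>m. rect (?D m))"
    using Cs(2) by (auto simp add: subset_eq) (metis prod.case prod_encode_inverse)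
  then have "mu_outer (\<Union>n. A n) \<le> (\<Sum>m. vol (?D m))"
    using Cs(1) by (intro mu_outer_le) (auto split: prod.split)
  also have "\<dots> = (\<Sum>n. \<Sum>k. vol (Cs n k))"
    using suminf_ennreal_2dimen[of "\<lambda>n. \<Sum>k. vol (Cs n k)" "\<lambda>x. vol (case_prod Cs x)"] by simp
  also have "\<dots> \<le> (\<Sum>n. mu_outer (A n) + e * (1/2) ^ Suc n)"
    by (intro suminf_le allI Cs) auto
  also have "... = (\<Sum>n. mu_outer (A n)) + (\<Sum>n. ennreal e * ennreal ((1/2) ^ Suc n))"
    using \<open>0 < e\<close> by (subst suminf_add[symmetric])
      (auto simp del: ennreal_suminf_cmult simp add: ennreal_mult[symmetric])
  also have "\<dots> = (\<Sum>n. mu_outer (A n)) + e"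
    unfolding ennreal_suminf_cmult
    by (subst suminf_ennreal_eq[OF zero_le_power power_half_series]) auto
  finally show "mu_outer (\<Union>n. A n) \<le> (\<Sum>n. mu_outer (A n)) + e" .
qed

lemma outer_measure_space_mu_outer: "outer_measure_space UNIV mu_outer"
  unfolding outer_measure_space_def positive_def increasing_def countably_subadditive_def
  by (auto intro: mu_outer_empty mu_outer_mono mu_outer_countably_subadditive)

text \<open>Caratheodory's lemma with the full power set as ambient algebra, so that the
  \<open>lambda_system\<close> consists of all Caratheodory measurable sets.\<close>

lemma measure_space_lambda_mu_outer:
  "measure_space UNIV (lambda_system UNIV UNIV mu_outer) mu_outer"
proof -
  interpret sigma_algebra "UNIV :: (nat \<Rightarrow> real) set" UNIV
    using sigma_algebra_Pow[of "UNIV :: (nat \<Rightarrow> real) set"] by simp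
  show ?thesis
    by (rule caratheodory_lemma[OF outer_measure_space_mu_outer])
qed

text \<open>Cutting every rectangle of a cover of \<open>X\<close> along coordinate \<open>j\<close>
  yields covers of both pieces of \<open>X\<close> with the same total volume, by
  \<open>vol_split\<close>. The reverse inequality is subadditivity.\<close>

lemma coordinate_set_in_lambda:
  assumes D: "D \<in> sets borel"
  shows "{x. x j \<in> D} \<in> lambda_system UNIV UNIV mu_outer"
proof -
  let ?Z = "{x :: nat \<Rightarrow> real. x j \<in> D}"
  have "mu_outer (?Z \<inter> X) + mu_outer ((UNIV - ?Z) \<inter> X) = mu_outer X" for X
  proof (rule antisym)
    show "mu_outer (?Z \<inter> X) + mu_outer ((UNIV - ?Z) \<inter> X) \<le> mu_outer X"
    proof (rule mu_outer_geI)
      fix Cs :: "nat \<Rightarrow> nat \<Rightarrow> real set" assume Cs: "\<And>n. is_finite_rect (Cs n)" and X: "X \<subseteq> (\<Union>n. rect (Cs n))"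
      let ?C1 = "\<lambda>n. (Cs n)(j := Cs n j \<inter> D)" and ?C2 = "\<lambda>n. (Cs n)(j := Cs n j - D)"
      have fin: "is_finite_rect (?C1 n)" "is_finite_rect (?C2 n)" for n
        using D finite_rect_borel[OF Cs] by (auto intro!: is_finite_rect_update Cs)
      have "?Z \<inter> X \<subseteq> (\<Union>n. rect (?C1 n))" "(UNIV - ?Z) \<inter> X \<subseteq> (\<Union>n. rect (?C2 n))"
        using X unfolding rect_def by (auto dest!: subsetD)
      then have "mu_outer (?Z \<inter> X) + mu_outer ((UNIV - ?Z) \<inter> X) \<le> (\<Sum>n. vol (?C1 n)) + (\<Sum>n. vol (?C2 n))"
        using fin by (intro add_mono mu_outer_le) auto
      also have "\<dots> = (\<Sum>n. vol (Cs n))"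
        by (subst suminf_add) (auto simp: vol_split[OF Cs D])
      finally show "mu_outer (?Z \<inter> X) + mu_outer ((UNIV - ?Z) \<inter> X) \<le> (\<Sum>n. vol (Cs n))" .
    qed
    \<comment> \<open>Subadditivity for two sets comes from the countable version, with the sequence
      continued by empty sets.\<close>
    have "mu_outer (\<Union>n. binaryset (?Z \<inter> X) ((UNIV - ?Z) \<inter> X) n) \<le>
        (\<Sum>n. mu_outer (binaryset (?Z \<inter> X) ((UNIV - ?Z) \<inter> X) n))"
      by (rule mu_outer_countably_subadditive)
    also have "\<dots> = mu_outer (?Z \<inter> X) + mu_outer ((UNIV - ?Z) \<inter> X)"
      by (rule suminf_binaryset_eq[where f = mu_outer]) (rule mu_outer_empty)
    also have "(\<Union>n. binaryset (?Z \<inter> X) ((UNIV - ?Z) \<inter> X) n) = X"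
      by (auto simp: UN_binaryset_eq)
    finally show "mu_outer X \<le> mu_outer (?Z \<inter> X) + mu_outer ((UNIV - ?Z) \<inter> X)" .
  qed
  then show ?thesis by (simp add: lambda_system_def)
qed

lemma cylinders_subset_lambda: "cylinders \<subseteq> lambda_system UNIV UNIV mu_outer"
proof
  interpret L: sigma_algebra UNIV "lambda_system UNIV UNIV mu_outer"
    using measure_space_lambda_mu_outer by (simp add: measure_space_def)
  fix A assume "A \<in> cylinders"
  then obtain m C where C: "\<forall>i<m. C i \<in> sets borel" "A = {x. \<forall>i<m. x i \<in> C i}"
    by (auto simp: cylinders_def)
  have "{x\<in>UNIV. \<forall>i\<in>{..<m}. x i \<in> C i} \<in> lambda_system UNIV UNIV mu_outer"
    using C(1) coordinate_set_in_lambda by (intro L.sets_Collect_finite_All) auto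
  then show "A \<in> lambda_system UNIV UNIV mu_outer"
    using C(2) by (simp add: Ball_def)
qed

lemma measure_space_mu_outer: "measure_space UNIV (sigma_sets UNIV cylinders) mu_outer"
proof (rule measure_down[OF measure_space_lambda_mu_outer])
  show "sigma_algebra UNIV (sigma_sets UNIV cylinders)"
    by (rule sigma_algebra_sigma_sets) simp
  show "sigma_sets UNIV cylinders \<subseteq> lambda_system UNIV UNIV mu_outer"
    using measure_space_lambda_mu_outer cylinders_subset_lambda
    by (intro sigma_algebra.sigma_sets_subset) (auto simp: measure_space_def)
qed

lemma space_mu[simp]: "space mu = UNIV"
  by (simp add: mu_def)

text \<open>A cylinder is a finite intersection of one-coordinate sets, and a one-coordinate set is
  a cylinder with \<open>UNIV\<close> in the earlier coordinates. The identification opens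
  \<open>mu\<close> to the measurability rules for product spaces.\<close>

lemma sets_mu[measurable_cong]: "sets mu = sets (Pi\<^sub>M UNIV (\<lambda>_. borel))"
proof -
  have "sets mu = sigma_sets UNIV cylinders"
    by (simp add: mu_def)
  also have "\<dots> = sets (Pi\<^sub>M UNIV (\<lambda>_. borel))"
    unfolding sets_PiM_single
  proof (simp, rule sigma_sets_eqI)
    fix A assume "A \<in> cylinders"
    then obtain m C where C: "\<forall>i<m. C i \<in> sets borel" "A = {x. \<forall>i<m. x i \<in> C i}"
      by (auto simp: cylinders_def)
    have "{x\<in>space (Pi\<^sub>M UNIV (\<lambda>_. borel)). \<forall>i\<in>{..<m}. x i \<in> C i} \<in> sets (Pi\<^sub>M (UNIV::nat set) (\<lambda>_. borel::real measure))"
      using C(1) by (intro sets.sets_Collect_finite_All sets_Collect_single') auto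
    then show "A \<in> sigma_sets UNIV {{f. f i \<in> A} |i A. A \<in> sets borel}"
      using C(2) unfolding sets_PiM_single by (simp add: space_PiM Ball_def)
  next
    fix A :: "(nat \<Rightarrow> real) set" assume "A \<in> {{f. f i \<in> A} |i A. A \<in> sets borel}"
    then obtain i D where D: "A = {x. x i \<in> D}" "D \<in> sets borel" by auto
    then have "A \<in> cylinders"
      unfolding cylinders_def by (auto intro!: exI[of _ "Suc i"] exI[of _ "\<lambda>k. if k = i then D else UNIV"])
    then show "A \<in> sigma_sets UNIV cylinders" by auto
  qed
  finally show ?thesis .
qed

text \<open>\<open>measure_of\<close> returns the given set function only if it is a measure on the
  generated \<sigma>-algebra, and the zero measure otherwise; \<open>measure_space_mu_outer\<close>
  excludes the second case.\<close>

lemma emeasure_mu: "A \<in> sets mu \<Longrightarrow> emeasure mu A = mu_outer A"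
  unfolding mu_def using measure_space_mu_outer
  by (subst emeasure_measure_of_conv) auto

subsection \<open>Binary digits of a uniform variable\<close>

text \<open>A density on the whole line keeps the underlying space equal to \<open>UNIV\<close>. The
  half-open interval matches the sides of the unit cubes.\<close>

definition uniform01 :: "real measure" where
  "uniform01 = density lborel (indicator {0..<1})"

lemma sets_uniform01[measurable_cong, simp]: "sets uniform01 = sets borel"
  and space_uniform01[simp]: "space uniform01 = UNIV"
  by (simp_all add: uniform01_def)

lemma emeasure_uniform01:
  "A \<in> sets borel \<Longrightarrow> emeasure uniform01 A = emeasure lborel (A \<inter> {0..<1})"
  unfolding uniform01_def
  by (subst emeasure_density)
    (auto simp: indicator_inter_arith[symmetric] Int_commute)

lemma nn_integral_uniform01:
  "f \<in> borel_measurable borel \<Longrightarrow>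
    (\<integral>\<^sup>+x. f x \<partial>uniform01) = (\<integral>\<^sup>+x. indicator {0..<1} x * f x \<partial>lborel)"
  by (simp add: uniform01_def nn_integral_density)

lemma AE_uniform01: "(AE t in uniform01. P t) \<longleftrightarrow> (AE t in lborel. t \<in> {0..<1} \<longrightarrow> P t)"
  unfolding uniform01_def by (subst AE_density) (auto simp: indicator_def)

lemma prob_space_uniform01: "prob_space uniform01"
  by (rule prob_spaceI) (simp add: emeasure_uniform01)

text \<open>This is conditioning on the first binary digit: the maps \<open>t / 2\<close> and
  \<open>(t + 1) / 2\<close> send the unit interval onto its two halves and scale length by
  1/2.\<close>

lemma nn_integral_uniform01_halves:
  assumes [measurable]: "g \<in> borel_measurable borel"
  shows "(\<integral>\<^sup>+t. g t \<partial>uniform01) =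
    ennreal (1/2) * ((\<integral>\<^sup>+t. g (t / 2) \<partial>uniform01) + (\<integral>\<^sup>+t. g ((t + 1) / 2) \<partial>uniform01))"
proof -
  have "(\<integral>\<^sup>+t. g t \<partial>uniform01) =
      (\<integral>\<^sup>+t. indicator {0..<1/2} t * g t + indicator {1/2..<1} t * g t \<partial>lborel)"
    by (subst nn_integral_uniform01) (auto intro!: nn_integral_cong split: split_indicator)
  also have "\<dots> = (\<integral>\<^sup>+t. indicator {0..<1/2} t * g t \<partial>lborel) + (\<integral>\<^sup>+t. indicator {1/2..<1} t * g t \<partial>lborel)"
    by (rule nn_integral_add) auto
  also have "(\<integral>\<^sup>+t. indicator {0..<1/2} t * g t \<partial>lborel) = ennreal (1/2) * (\<integral>\<^sup>+t. g (t / 2) \<partial>uniform01)"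
    by (subst nn_integral_real_affine[where c="1/2" and t=0])
      (auto simp: nn_integral_uniform01 intro!: arg_cong2[where f="(*)"] nn_integral_cong split: split_indicator)
  also have "(\<integral>\<^sup>+t. indicator {1/2..<1} t * g t \<partial>lborel) = ennreal (1/2) * (\<integral>\<^sup>+t. g ((t + 1) / 2) \<partial>uniform01)"
    by (subst nn_integral_real_affine[where c="1/2" and t="1/2"])
      (auto simp: nn_integral_uniform01 add_divide_distrib add.commute
        intro!: arg_cong2[where f="(*)"] nn_integral_cong split: split_indicator)
  finally show ?thesis by (simp add: distrib_left)
qed

section \<open>The law of the binary digits\<close>

definition coin :: "bool measure" where
  "coin = measure_pmf (bernoulli_pmf (1/2))"

lemma sets_coin[measurable_cong, simp]: "sets coin = sets (count_space UNIV)"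
  and space_coin[simp]: "space coin = UNIV"
  by (simp_all add: coin_def)

lemma prob_space_coin: "prob_space coin"
  unfolding coin_def by (rule measure_pmf.prob_space_axioms)

lemma emeasure_coin:
  "emeasure coin A = ennreal (1/2) * (indicator A False + indicator A True)"
proof -
  have "emeasure coin A = (\<integral>\<^sup>+b. indicator A b \<partial>measure_pmf (bernoulli_pmf (1/2)))"
    by (simp add: coin_def)
  also have "\<dots> = ennreal (1/2) * (indicator A False + indicator A True)"
    by (subst nn_integral_bernoulli_pmf) (auto simp: distrib_left mult.commute add.commute)
  finally show ?thesis .
qed

abbreviation coins :: "(nat \<Rightarrow> bool) measure" where
  "coins \<equiv> Pi\<^sub>M UNIV (\<lambda>_. coin)"

abbreviation cube_measure :: "(nat \<Rightarrow> real) measure" where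
  "cube_measure \<equiv> Pi\<^sub>M UNIV (\<lambda>_. uniform01)"

interpretation coins: product_prob_space "\<lambda>_. coin" "UNIV :: nat set"
  unfolding product_prob_space_def product_prob_space_axioms_def product_sigma_finite_def
  by (simp add: prob_space_coin prob_space_imp_sigma_finite)

interpretation cube: product_prob_space "\<lambda>_. uniform01" "UNIV :: nat set"
  unfolding product_prob_space_def product_prob_space_axioms_def product_sigma_finite_def
  by (simp add: prob_space_uniform01 prob_space_imp_sigma_finite)

lemma space_coins[simp]: "space coins = UNIV"
  by (simp add: space_PiM)

lemma space_cube_measure[simp]: "space cube_measure = UNIV"
  by (simp add: space_PiM)

text \<open>Digits are counted from 0, hence \<open>Suc k\<close>. For a dyadic rational the floor
  selects the expansion that ends in zeros.\<close>

definition digit :: "real \<Rightarrow> nat \<Rightarrow> bool" where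
  "digit t k = odd \<lfloor>2 ^ Suc k * t\<rfloor>"

lemma measurable_digit_component[measurable]: "(\<lambda>t. digit t k) \<in> measurable borel (count_space UNIV)"
  unfolding digit_def by measurable

lemma measurable_digit[measurable]: "digit \<in> measurable borel coins"
proof -
  have "(\<lambda>t k. digit t k) \<in> measurable borel coins"
    by (rule measurable_PiM_single') auto
  then show ?thesis by simp
qed

text \<open>Halving prepends a digit to the expansion of \<open>s\<close>: false for the left half
  and true for the right half.\<close>

lemma digit_half:
  assumes "0 \<le> s" "s < 1"
  shows "digit (s / 2) 0 = False" "digit ((s + 1) / 2) 0 = True"
    and "digit (s / 2) (Suc k) = digit s k" "digit ((s + 1) / 2) (Suc k) = digit s k"
proof -
  have "\<lfloor>s\<rfloor> = 0" using assms by (simp add: floor_eq_iff)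
  moreover have "2 * ((s + 1) / 2) = s + 1" by simp
  ultimately show "digit (s / 2) 0 = False" "digit ((s + 1) / 2) 0 = True"
    unfolding digit_def by (simp_all only: power_one_right One_nat_def[symmetric]) simp_all
  have "2 ^ Suc (Suc k) * (s / 2) = 2 ^ Suc k * s"
    by simp
  then show "digit (s / 2) (Suc k) = digit s k"
    unfolding digit_def by (simp only:)
  \<comment> \<open>The integer shift \<open>2 ^ Suc k\<close> is even, so it does not change the
    parity of the floor.\<close>
  have "2 ^ Suc (Suc k) * ((s + 1) / 2) = 2 ^ Suc k * s + of_int (2 ^ Suc k)"
    by (simp add: field_simps)
  then have "\<lfloor>2 ^ Suc (Suc k) * ((s + 1) / 2)\<rfloor> = \<lfloor>2 ^ Suc k * s\<rfloor> + 2 ^ Suc k"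
    by (simp only: floor_add_int)
  then show "digit ((s + 1) / 2) (Suc k) = digit s k"
    by (simp add: digit_def)
qed

text \<open>The induction peels off the first digit: on each half the condition on digit 0 is
  constant, and the later digits are those of the rescaled point, to which the hypothesis applies
  with the shifted family \<open>A (Suc k)\<close>.\<close>

lemma emeasure_uniform01_digits:
  "emeasure uniform01 {t. \<forall>k<n. digit t k \<in> A k} = (\<Prod>k<n. emeasure coin (A k))"
proof (induction n arbitrary: A)
  case 0
  show ?case using prob_space.emeasure_space_1[OF prob_space_uniform01] by simp
next
  case (Suc n)
  let ?E = "\<lambda>n A. {t. \<forall>k<n. digit t k \<in> A k}"
  have [measurable]: "?E n A \<in> sets borel" for n and A :: "nat \<Rightarrow> bool set"
    by measurable
  have "emeasure uniform01 (?E (Suc n) A) = (\<integral>\<^sup>+t. indicator (?E (Suc n) A) t \<partial>uniform01)"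
    by simp
  also have "\<dots> = ennreal (1/2) * ((\<integral>\<^sup>+t. indicator (?E (Suc n) A) (t / 2) \<partial>uniform01) +
      (\<integral>\<^sup>+t. indicator (?E (Suc n) A) ((t + 1) / 2) \<partial>uniform01))"
    by (rule nn_integral_uniform01_halves) measurable
  also have "(\<integral>\<^sup>+t. indicator (?E (Suc n) A) (t / 2) \<partial>uniform01) =
      (\<integral>\<^sup>+t. indicator (A 0) False * indicator (?E n (\<lambda>k. A (Suc k))) t \<partial>uniform01)"
    by (intro nn_integral_cong_AE)
      (auto simp: AE_uniform01 indicator_def digit_half All_less_Suc2)
  also have "(\<integral>\<^sup>+t. indicator (?E (Suc n) A) ((t + 1) / 2) \<partial>uniform01) =
      (\<integral>\<^sup>+t. indicator (A 0) True * indicator (?E n (\<lambda>k. A (Suc k))) t \<partial>uniform01)"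
    by (intro nn_integral_cong_AE)
      (auto simp: AE_uniform01 indicator_def digit_half All_less_Suc2)
  also have "ennreal (1/2) * ((\<integral>\<^sup>+t. indicator (A 0) False * indicator (?E n (\<lambda>k. A (Suc k))) t \<partial>uniform01) +
      (\<integral>\<^sup>+t. indicator (A 0) True * indicator (?E n (\<lambda>k. A (Suc k))) t \<partial>uniform01)) =
      emeasure coin (A 0) * emeasure uniform01 (?E n (\<lambda>k. A (Suc k)))"
    by (simp add: nn_integral_cmult emeasure_coin distrib_left distrib_right mult.assoc)
  finally show ?case
    by (simp add: Suc.IH prod.lessThan_Suc_shift del: prod.lessThan_Suc)
qed

lemma distr_digit: "distr uniform01 coins digit = coins"
proof (rule coins.PiM_eq)
  fix J :: "nat set" and F :: "nat \<Rightarrow> bool set"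
  assume J: "finite J"
  then obtain n where n: "J \<subseteq> {..<n}"
    using finite_nat_iff_bounded by auto
  \<comment> \<open>Unconstrained positions get \<open>UNIV\<close>, whose probability is 1, so
    \<open>J\<close> may be enlarged to an initial segment.\<close>
  let ?F = "\<lambda>k. if k \<in> J then F k else UNIV"
  have "emeasure (distr uniform01 coins digit) (prod_emb UNIV (\<lambda>_. coin) J (Pi\<^sub>E J F)) =
      emeasure uniform01 (digit -` (prod_emb UNIV (\<lambda>_. coin) J (Pi\<^sub>E J F)) \<inter> space uniform01)"
    using J by (intro emeasure_distr) (auto intro!: sets_PiM_I)
  also have "digit -` (prod_emb UNIV (\<lambda>_. coin) J (Pi\<^sub>E J F)) \<inter> space uniform01 = {t. \<forall>k<n. digit t k \<in> ?F k}"
    using n by (fastforce simp: prod_emb_def PiE_iff)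
  also have "emeasure uniform01 {t. \<forall>k<n. digit t k \<in> ?F k} = (\<Prod>k<n. emeasure coin (?F k))"
    by (rule emeasure_uniform01_digits)
  also have "\<dots> = (\<Prod>k\<in>J. emeasure coin (F k))"
    using n prob_space.emeasure_space_1[OF prob_space_coin]
    by (intro prod.mono_neutral_cong_right) auto
  finally show "emeasure (distr uniform01 coins digit) (prod_emb UNIV (\<lambda>_. coin) J (Pi\<^sub>E J F)) =
      (\<Prod>k\<in>J. emeasure coin (F k))" .
qed simp

definition binary_value :: "(nat \<Rightarrow> bool) \<Rightarrow> real" where
  "binary_value \<omega> = (\<Sum>k. of_bool (\<omega> k) / 2 ^ Suc k)"

lemma measurable_binary_value[measurable]: "binary_value \<in> borel_measurable coins"
  unfolding binary_value_def by measurable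

text \<open>The partial sums are the truncations \<open>\<lfloor>2 ^ n * t\<rfloor> / 2 ^ n\<close>,
  which differ from \<open>t\<close> by at most \<open>(1/2) ^ n\<close>.\<close>

lemma binary_value_digit:
  assumes "0 \<le> t" "t < 1"
  shows "binary_value (digit t) = t"
proof -
  have partial: "(\<Sum>k<n. of_bool (digit t k) / 2 ^ Suc k) = real_of_int \<lfloor>2 ^ n * t\<rfloor> / 2 ^ n" for n
  proof (induction n)
    case 0
    have "\<lfloor>t\<rfloor> = 0" using assms by (simp add: floor_eq_iff)
    then show ?case by simp
  next
    case (Suc n)
    \<comment> \<open>The remainder of this division by 2 is exactly digit \<open>n\<close>.\<close>
    have "\<lfloor>2 ^ n * t\<rfloor> = \<lfloor>2 ^ Suc n * t\<rfloor> div 2"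
      using floor_divide_real_eq_div[of 2 "2 ^ Suc n * t"] by simp
    then have "\<lfloor>2 ^ Suc n * t\<rfloor> = 2 * \<lfloor>2 ^ n * t\<rfloor> + of_bool (digit t n)"
      by (auto simp: digit_def elim!: oddE)
    then have "real_of_int \<lfloor>2 ^ Suc n * t\<rfloor> = 2 * of_int \<lfloor>2 ^ n * t\<rfloor> + of_bool (digit t n)"
      by (metis (mono_tags) of_int_add of_int_mult of_int_numeral of_int_of_bool)
    with Suc show ?case by (simp add: field_simps)
  qed
  have "(\<lambda>n. real_of_int \<lfloor>2 ^ n * t\<rfloor> / 2 ^ n) \<longlonglongrightarrow> t"
  proof (rule tendsto_sandwich)
    have "(\<lambda>n. t - (1/2) ^ n) \<longlonglongrightarrow> t - 0"
      by (intro tendsto_intros LIMSEQ_realpow_zero) auto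
    then show "(\<lambda>n. t - (1/2) ^ n) \<longlonglongrightarrow> t" by simp
    show "eventually (\<lambda>n. t - (1/2) ^ n \<le> real_of_int \<lfloor>2 ^ n * t\<rfloor> / 2 ^ n) sequentially"
    proof (rule always_eventually, rule allI)
      fix n
      have "2 ^ n * t - 1 \<le> of_int \<lfloor>2 ^ n * t\<rfloor>" by linarith
      then have "(2 ^ n * t - 1) / 2 ^ n \<le> of_int \<lfloor>2 ^ n * t\<rfloor> / 2 ^ n"
        by (rule divide_right_mono) simp
      then show "t - (1/2) ^ n \<le> real_of_int \<lfloor>2 ^ n * t\<rfloor> / 2 ^ n"
        by (simp add: diff_divide_distrib power_one_over)
    qed
    show "eventually (\<lambda>n. real_of_int \<lfloor>2 ^ n * t\<rfloor> / 2 ^ n \<le> t) sequentially"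
    proof (rule always_eventually, rule allI)
      fix n
      have "of_int \<lfloor>2 ^ n * t\<rfloor> \<le> 2 ^ n * t" by linarith
      then show "real_of_int \<lfloor>2 ^ n * t\<rfloor> / 2 ^ n \<le> t"
        by (simp add: field_simps)
    qed
  qed simp
  then have "(\<lambda>k. of_bool (digit t k) / 2 ^ Suc k) sums t"
    unfolding sums_def partial .
  then show ?thesis
    unfolding binary_value_def by (rule sums_unique[symmetric])
qed

lemma distr_binary_value: "distr coins borel binary_value = uniform01"
proof -
  have "distr coins borel binary_value = distr (distr uniform01 coins digit) borel binary_value"
    by (simp add: distr_digit)
  also have "\<dots> = distr uniform01 borel (binary_value \<circ> digit)"
    by (rule distr_distr) measurable
  also have "\<dots> = distr uniform01 borel (\<lambda>t. t)"
    by (intro distr_cong_AE) (auto simp: AE_uniform01 binary_value_digit)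
  also have "\<dots> = uniform01"
    by (rule distr_id2) simp
  finally show ?thesis .
qed

text \<open>Since \<open>coins\<close> is the law of \<open>digit\<close>, it is enough to test
  sequences of the form \<open>digit t\<close> with \<open>t\<close> in the unit interval, where
  \<open>binary_value_digit\<close> applies. The sequences that end in ones need no separate
  count.\<close>

lemma AE_digit_binary_value: "AE \<omega> in coins. digit (binary_value \<omega>) = \<omega>"
proof -
  have meas: "{\<omega> \<in> space coins. \<forall>k. digit (binary_value \<omega>) k = \<omega> k} \<in> sets coins"
    by measurable
  have "AE \<omega> in distr uniform01 coins digit. \<forall>k. digit (binary_value \<omega>) k = \<omega> k"
    by (subst AE_distr_iff[OF _ meas]) (auto simp: AE_uniform01 binary_value_digit)
  then show ?thesis unfolding distr_digit fun_eq_iff .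
qed

section \<open>Merging the digits of countably many reals into one sequence\<close>

definition interleave :: "(nat \<Rightarrow> real) \<Rightarrow> nat \<Rightarrow> bool" where
  "interleave x m = digit (x (fst (prod_decode m))) (snd (prod_decode m))"

lemma measurable_interleave[measurable]: "interleave \<in> measurable (Pi\<^sub>M UNIV (\<lambda>_. borel)) coins"
proof -
  have "(\<lambda>x m. interleave x m) \<in> measurable (Pi\<^sub>M UNIV (\<lambda>_. borel)) coins"
    unfolding interleave_def by (rule measurable_PiM_single') (auto simp: space_PiM)
  then show ?thesis by simp
qed

lemma sets_cube_measure[measurable_cong]: "sets cube_measure = sets (Pi\<^sub>M UNIV (\<lambda>_. borel))"
  by (rule sets_PiM_cong) auto

text \<open>A condition on finitely many positions splits into conditions on the digits of finitely
  many coordinates. Distinct coordinates are independent under the product measure, and digits of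
  one coordinate are independent by \<open>distr_digit\<close>; the double product is reindexed by
  the pairing function.\<close>

lemma distr_interleave: "distr cube_measure coins interleave = coins"
proof (rule coins.PiM_eq)
  fix J :: "nat set" and F :: "nat \<Rightarrow> bool set"
  assume J: "finite J"
  \<comment> \<open>\<open>N\<close> collects the coordinates met by \<open>J\<close>,
    \<open>K n\<close> the constrained digits of coordinate \<open>n\<close>, and \<open>X n\<close>
    the resulting condition on that coordinate.\<close>
  define N where "N = (fst \<circ> prod_decode) ` J"
  define K where "K n = {k. prod_encode (n, k) \<in> J}" for n
  define X where "X n = {t. \<forall>k\<in>K n. digit t k \<in> F (prod_encode (n, k))}" for n
  have N: "finite N" using J by (simp add: N_def)
  have K: "finite (K n)" for n
    unfolding K_def using J by (intro finite_vimageI[of J "\<lambda>k. prod_encode (n, k)", unfolded vimage_def]) (auto intro: injI)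
  have X: "emeasure uniform01 (X n) = (\<Prod>k\<in>K n. emeasure coin (F (prod_encode (n, k))))" for n
  proof -
    have "emeasure uniform01 (X n) = emeasure uniform01
        (digit -` {\<omega>\<in>space coins. \<forall>k\<in>K n. \<omega> k \<in> F (prod_encode (n, k))} \<inter> space uniform01)"
      by (simp add: X_def vimage_def)
    also have "\<dots> = emeasure (distr uniform01 coins digit) {\<omega>\<in>space coins. \<forall>k\<in>K n. \<omega> k \<in> F (prod_encode (n, k))}"
      using K by (intro emeasure_distr[symmetric] sets.sets_Collect_finite_All sets_Collect_single') auto
    also have "\<dots> = (\<Prod>k\<in>K n. emeasure coin (F (prod_encode (n, k))))"
      unfolding distr_digit using K by (intro coins.emeasure_PiM_Collect) auto
    finally show ?thesis .
  qed
  have [measurable]: "X n \<in> sets borel" for n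
    unfolding X_def using K by measurable
  have "emeasure (distr cube_measure coins interleave) (prod_emb UNIV (\<lambda>_. coin) J (Pi\<^sub>E J F)) =
      emeasure cube_measure (interleave -` (prod_emb UNIV (\<lambda>_. coin) J (Pi\<^sub>E J F)) \<inter> space cube_measure)"
    using J by (intro emeasure_distr) (auto intro!: sets_PiM_I)
  also have "interleave -` (prod_emb UNIV (\<lambda>_. coin) J (Pi\<^sub>E J F)) \<inter> space cube_measure =
      {x\<in>space cube_measure. \<forall>n\<in>N. x n \<in> X n}"
  proof -
    have "(\<forall>m\<in>J. interleave x m \<in> F m) \<longleftrightarrow> (\<forall>n\<in>N. x n \<in> X n)" for x
    proof safe
      fix n assume "\<forall>m\<in>J. interleave x m \<in> F m"
      moreover have "interleave x (prod_encode (n, k)) = digit (x n) k" for k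
        by (simp add: interleave_def)
      ultimately show "x n \<in> X n"
        unfolding X_def K_def by (auto dest!: bspec)
    next
      fix m assume *: "\<forall>n\<in>N. x n \<in> X n" and m: "m \<in> J"
      then have "x (fst (prod_decode m)) \<in> X (fst (prod_decode m))"
        by (auto simp: N_def)
      then show "interleave x m \<in> F m"
        using m by (auto simp: X_def K_def interleave_def dest!: spec[where x="snd (prod_decode m)"])
    qed
    moreover have "interleave -` (prod_emb UNIV (\<lambda>_. coin) J (Pi\<^sub>E J F)) \<inter> space cube_measure =
        {x. \<forall>m\<in>J. interleave x m \<in> F m}"
      by (auto simp: prod_emb_def PiE_iff)
    ultimately show ?thesis by (simp only: space_cube_measure UNIV_I simp_thms)
  qed
  also have "emeasure cube_measure \<dots> = (\<Prod>n\<in>N. emeasure uniform01 (X n))"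
    using N by (intro cube.emeasure_PiM_Collect) auto
  also have "\<dots> = (\<Prod>(n, k)\<in>Sigma N K. emeasure coin (F (prod_encode (n, k))))"
    using N K by (simp add: X prod.Sigma)
  also have "\<dots> = (\<Prod>m\<in>J. emeasure coin (F m))"
  proof (rule prod.reindex_bij_witness[where i=prod_decode and j=prod_encode])
    fix m assume m: "m \<in> J"
    obtain n k where nk: "prod_decode m = (n, k)" by (cases "prod_decode m")
    then have "m = prod_encode (n, k)" by (metis prod_decode_inverse)
    then show "prod_decode m \<in> Sigma N K"
      using m by (force simp: N_def K_def image_iff)
  qed (auto simp: K_def)
  finally show "emeasure (distr cube_measure coins interleave) (prod_emb UNIV (\<lambda>_. coin) J (Pi\<^sub>E J F)) =
      (\<Prod>m\<in>J. emeasure coin (F m))" .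
qed simp

definition cube_to_interval :: "(nat \<Rightarrow> real) \<Rightarrow> real" where
  "cube_to_interval x = binary_value (interleave x)"

text \<open>The fractional part only matters for a constantly true digit sequence, whose binary value is
  \<open>1\<close>; it puts the image inside the half-open cube for every argument.\<close>

definition interval_to_cube :: "real \<Rightarrow> nat \<Rightarrow> real" where
  "interval_to_cube t n = frac (binary_value (\<lambda>k. digit t (prod_encode (n, k))))"

lemma measurable_cube_to_interval[measurable]:
  "cube_to_interval \<in> borel_measurable (Pi\<^sub>M UNIV (\<lambda>_. borel))"
  unfolding cube_to_interval_def by measurable

lemma measurable_interval_to_cube[measurable]:
  "interval_to_cube \<in> measurable borel (Pi\<^sub>M UNIV (\<lambda>_. borel))"
proof -
  have "(\<lambda>t n. interval_to_cube t n) \<in> measurable borel (Pi\<^sub>M UNIV (\<lambda>_. borel))"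
  proof (rule measurable_PiM_single')
    fix n
    have "(\<lambda>t k. digit t (prod_encode (n, k))) \<in> measurable borel coins"
      by (rule measurable_PiM_single') auto
    then show "(\<lambda>t. interval_to_cube t n) \<in> borel_measurable borel"
      unfolding interval_to_cube_def frac_def by measurable
  qed simp
  then show ?thesis by simp
qed

lemma interval_to_cube_bounds: "0 \<le> interval_to_cube t n" "interval_to_cube t n < 1"
  by (simp_all add: interval_to_cube_def frac_lt_1)

lemma distr_cube_to_interval: "distr cube_measure borel cube_to_interval = uniform01"
proof -
  have "distr cube_measure borel cube_to_interval = distr (distr cube_measure coins interleave) borel binary_value"
    by (subst distr_distr) (auto simp: comp_def cube_to_interval_def[abs_def])
  then show ?thesis by (simp add: distr_interleave distr_binary_value)
qed

text \<open>Almost surely the digits of the merged number are the merged digits, so reading off row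
  \<open>n\<close> recovers the digits of \<open>x n\<close> and hence \<open>x n\<close>
  itself.\<close>

lemma AE_interval_to_cube_to_interval:
  "AE x in cube_measure. interval_to_cube (cube_to_interval x) = x"
proof -
  have "AE \<omega> in distr cube_measure coins interleave. digit (binary_value \<omega>) = \<omega>"
    unfolding distr_interleave by (rule AE_digit_binary_value)
  then have "AE x in cube_measure. digit (binary_value (interleave x)) = interleave x"
    by (rule AE_distrD[rotated]) measurable
  \<comment> \<open>\<open>cube_measure\<close> lives on all real sequences, so its points lie in
    the half-open cube only almost surely.\<close>
  moreover have "AE x in cube_measure. \<forall>n. x n \<in> {0..<1}"
    unfolding AE_all_countable
    by (intro allI AE_PiM_component) (auto simp: prob_space_uniform01 AE_uniform01)
  ultimately show ?thesis
  proof eventually_elim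
    case (elim x)
    show ?case
    proof
      fix n
      have "interval_to_cube (cube_to_interval x) n = frac (binary_value (\<lambda>k. interleave x (prod_encode (n, k))))"
        using elim(1) by (simp add: interval_to_cube_def cube_to_interval_def)
      also have "(\<lambda>k. interleave x (prod_encode (n, k))) = digit (x n)"
        by (simp add: interleave_def fun_eq_iff)
      also have "frac (binary_value (digit (x n))) = x n"
        using elim(2) by (simp add: binary_value_digit frac_eq)
      finally show "interval_to_cube (cube_to_interval x) n = x n" .
    qed
  qed
qed

text \<open>As \<open>uniform01\<close> is the law of \<open>cube_to_interval\<close>, one may take
  \<open>t = cube_to_interval x\<close> and use the opposite composition at
  \<open>x\<close>.\<close>

lemma AE_cube_to_interval_to_cube: "AE t in uniform01. cube_to_interval (interval_to_cube t) = t"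
proof -
  have "AE t in distr cube_measure borel cube_to_interval. cube_to_interval (interval_to_cube t) = t"
    using AE_interval_to_cube_to_interval by (subst AE_distr_iff) auto
  then show ?thesis unfolding distr_cube_to_interval .
qed

lemma distr_interval_to_cube: "distr uniform01 cube_measure interval_to_cube = cube_measure"
proof -
  have "distr uniform01 cube_measure interval_to_cube =
      distr (distr cube_measure borel cube_to_interval) cube_measure interval_to_cube"
    by (simp only: distr_cube_to_interval)
  also have "\<dots> = distr cube_measure cube_measure (interval_to_cube \<circ> cube_to_interval)"
    by (rule distr_distr) measurable
  also have "\<dots> = distr cube_measure cube_measure (\<lambda>x. x)"
    using AE_interval_to_cube_to_interval by (intro distr_cong_AE) auto
  also have "\<dots> = cube_measure" by (rule distr_id)
  finally show ?thesis .
qed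

subsection \<open>Unit cubes as probability spaces\<close>

definition translate :: "(nat \<Rightarrow> int) \<Rightarrow> (nat \<Rightarrow> real) \<Rightarrow> nat \<Rightarrow> real" where
  "translate a x = (\<lambda>n. of_int (a n) + x n)"

lemma measurable_translate[measurable]:
  "translate a \<in> measurable (Pi\<^sub>M UNIV (\<lambda>_. borel)) (Pi\<^sub>M UNIV (\<lambda>_. borel))"
  unfolding translate_def by (rule measurable_PiM_single') (auto simp: space_PiM)

text \<open>The cubes are the fibres of the coordinatewise floor, which gives their disjointness and
  lets a point name its own cube.\<close>

lemma mem_unit_cube_iff: "x \<in> unit_cube a \<longleftrightarrow> (\<lambda>n. \<lfloor>x n\<rfloor>) = a"
  by (auto simp: unit_cube_def fun_eq_iff floor_eq_iff)

lemma floor_translate_interval_to_cube: "\<lfloor>translate a (interval_to_cube t) n\<rfloor> = a n"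
  using interval_to_cube_bounds[of t n] by (simp add: translate_def floor_eq_iff)

lemma frac_translate_interval_to_cube: "frac (translate a (interval_to_cube t) n) = interval_to_cube t n"
  using floor_translate_interval_to_cube[of a t n] by (simp add: frac_def translate_def)

lemma unit_cube_eq_rect: "unit_cube a = rect (\<lambda>n. {of_int (a n)..<of_int (a n) + 1})"
  by (auto simp: unit_cube_def rect_def)

lemma sets_rect:
  assumes "\<And>i. C i \<in> sets borel"
  shows "rect C \<in> sets mu"
proof -
  have "{x\<in>space (Pi\<^sub>M UNIV (\<lambda>_. borel)). \<forall>i. x i \<in> C i} \<in> sets (Pi\<^sub>M (UNIV :: nat set) (\<lambda>_. borel :: real measure))"
    using assms by (intro sets.sets_Collect_countable_All sets_Collect_single') auto
  then show ?thesis by (simp add: rect_def sets_mu space_PiM)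
qed

lemma sets_unit_cube[measurable]: "unit_cube a \<in> sets mu"
  unfolding unit_cube_eq_rect by (rule sets_rect) simp

text \<open>Pushing forward from the interval makes the change of variables for integrals immediate;
  \<open>cube_law_eq\<close> gives the form as a translated product measure, which is the one suited
  to rectangles.\<close>

definition cube_law :: "(nat \<Rightarrow> int) \<Rightarrow> (nat \<Rightarrow> real) measure" where
  "cube_law a = distr uniform01 mu (\<lambda>t. translate a (interval_to_cube t))"

lemma sets_cube_law[simp, measurable_cong]: "sets (cube_law a) = sets mu"
  and space_cube_law[simp]: "space (cube_law a) = UNIV"
  by (simp_all add: cube_law_def)

lemma cube_law_eq: "cube_law a = distr cube_measure mu (translate a)"
proof -
  have "distr cube_measure mu (translate a) = distr (distr uniform01 cube_measure interval_to_cube) mu (translate a)"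
    by (simp only: distr_interval_to_cube)
  also have "\<dots> = distr uniform01 mu (translate a \<circ> interval_to_cube)"
    by (rule distr_distr) measurable
  finally show ?thesis by (simp add: cube_law_def comp_def)
qed

lemma prob_space_cube_law: "prob_space (cube_law a)"
  unfolding cube_law_def by (rule prob_space.prob_space_distr[OF prob_space_uniform01]) measurable

lemma emeasure_cube_law_unit_cube: "emeasure (cube_law a) (unit_cube a) = 1"
proof -
  have "emeasure (cube_law a) (unit_cube a) =
      emeasure uniform01 ((\<lambda>t. translate a (interval_to_cube t)) -` unit_cube a \<inter> space uniform01)"
    unfolding cube_law_def by (rule emeasure_distr) measurable
  also have "(\<lambda>t. translate a (interval_to_cube t)) -` unit_cube a \<inter> space uniform01 = space uniform01"
    by (simp add: vimage_def mem_unit_cube_iff floor_translate_interval_to_cube)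
  finally show ?thesis
    by (simp only: prob_space.emeasure_space_1[OF prob_space_uniform01])
qed

text \<open>Keeping only the first \<open>n\<close> coordinates bounds the probability by a product
  of probabilities, each at most a Lebesgue measure by translation invariance. The bound survives
  \<open>n\<close> tending to infinity.\<close>

lemma emeasure_cube_law_rect_le:
  assumes C: "is_finite_rect C"
  shows "emeasure (cube_law a) (rect C) \<le> vol C"
proof (rule tendsto_lowerbound[OF tendsto_vol[OF C]])
  have [measurable]: "C i \<in> sets borel" for i using C by (rule finite_rect_borel)
  have shift: "emeasure uniform01 {s. of_int (a i) + s \<in> C i} \<le> emeasure lborel (C i)" for i
  proof -
    have "emeasure uniform01 {s. of_int (a i) + s \<in> C i} \<le> emeasure lborel {s. of_int (a i) + s \<in> C i}"
      by (subst emeasure_uniform01) (auto intro!: emeasure_mono)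
    also have "\<dots> = emeasure (distr lborel borel ((+) (of_int (a i)))) (C i)"
      by (subst emeasure_distr) (auto simp: vimage_def)
    finally show ?thesis by (simp add: lborel_distr_plus)
  qed
  have "emeasure (cube_law a) (rect C) \<le> (\<Prod>i<n. emeasure lborel (C i))" for n
  proof -
    let ?E = "{x\<in>space cube_measure. \<forall>i\<in>{..<n}. x i \<in> {s. of_int (a i) + s \<in> C i}}"
    have "emeasure (cube_law a) (rect C) = emeasure cube_measure (translate a -` rect C \<inter> space cube_measure)"
      unfolding cube_law_eq by (rule emeasure_distr) (auto intro: sets_rect)
    also have "\<dots> \<le> emeasure cube_measure ?E"
      by (intro emeasure_mono sets.sets_Collect_finite_All sets_Collect_single')
        (auto simp: rect_def translate_def)
    also have "\<dots> = (\<Prod>i<n. emeasure uniform01 {s. of_int (a i) + s \<in> C i})"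
      by (rule cube.emeasure_PiM_Collect) auto
    also have "\<dots> \<le> (\<Prod>i<n. emeasure lborel (C i))"
      by (induction n) (auto intro!: mult_mono shift)
    finally show ?thesis .
  qed
  then show "eventually (\<lambda>n. emeasure (cube_law a) (rect C) \<le> (\<Prod>i<n. emeasure lborel (C i))) sequentially"
    by simp
qed simp

lemma emeasure_cube_law_le:
  assumes A: "A \<in> sets mu"
  shows "emeasure (cube_law a) A \<le> emeasure mu A"
  unfolding emeasure_mu[OF A]
proof (rule mu_outer_geI)
  fix Cs :: "nat \<Rightarrow> nat \<Rightarrow> real set"
  assume Cs: "\<And>n. is_finite_rect (Cs n)" and sub: "A \<subseteq> (\<Union>n. rect (Cs n))"
  have meas: "rect (Cs n) \<in> sets (cube_law a)" for n
    using finite_rect_borel[OF Cs] by (simp add: sets_rect)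
  have "emeasure (cube_law a) A \<le> emeasure (cube_law a) (\<Union>n. rect (Cs n))"
    using sub meas by (intro emeasure_mono sets.countable_UN) auto
  also have "\<dots> \<le> (\<Sum>n. emeasure (cube_law a) (rect (Cs n)))"
    using meas by (intro emeasure_subadditive_countably) auto
  also have "\<dots> \<le> (\<Sum>n. vol (Cs n))"
    by (intro suminf_le emeasure_cube_law_rect_le Cs) auto
  finally show "emeasure (cube_law a) A \<le> (\<Sum>n. vol (Cs n))" .
qed

text \<open>The cube covers itself, and all its partial products equal 1.\<close>

lemma emeasure_mu_unit_cube_le: "emeasure mu (unit_cube a) \<le> 1"
proof -
  let ?C = "\<lambda>n. {of_int (a n)..<of_int (a n) + 1 :: real}"
  let ?Cs = "\<lambda>k. if k = 0 then ?C else (\<lambda>_. {})"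
  have lim: "(\<lambda>n. \<Prod>i<n. emeasure lborel (?C i)) \<longlonglongrightarrow> 1"
    by simp
  have fin: "is_finite_rect ?C"
    unfolding is_finite_rect_def using lim by (auto intro!: exI[of _ 1])
  have vol: "vol ?C = 1"
    unfolding vol_def using lim by (rule limI)
  have "emeasure mu (unit_cube a) = mu_outer (unit_cube a)"
    by (rule emeasure_mu) measurable
  also have "\<dots> \<le> (\<Sum>k. vol (?Cs k))"
    using fin by (intro mu_outer_le) (auto simp: empty_rect unit_cube_eq_rect)
  also have "\<dots> = (\<Sum>k\<in>{0}. vol (?Cs k))"
    using suminf_finite[of "{0}" "\<lambda>k. vol (?Cs k)"] by (simp add: empty_rect)
  finally show ?thesis by (simp add: vol)
qed

lemma emeasure_cube_law:
  assumes A[measurable]: "A \<in> sets mu"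
  shows "emeasure (cube_law a) A = emeasure mu (A \<inter> unit_cube a)"
proof -
  interpret prob_space "cube_law a" by (rule prob_space_cube_law)
  let ?B = "A \<inter> unit_cube a" and ?D = "unit_cube a - A"
  \<comment> \<open>The finite term \<open>emeasure (cube_law a) ?D\<close> cancels at the end of
    this chain, leaving the inequality opposite to \<open>emeasure_cube_law_le\<close>.\<close>
  have "emeasure mu ?B + emeasure (cube_law a) ?D \<le> emeasure mu ?B + emeasure mu ?D"
    by (intro add_left_mono emeasure_cube_law_le) measurable
  also have "\<dots> = emeasure mu (unit_cube a)"
    by (subst plus_emeasure) (auto intro!: arg_cong[where f="emeasure mu"])
  also have "\<dots> \<le> emeasure (cube_law a) (unit_cube a)"
    by (simp add: emeasure_mu_unit_cube_le emeasure_cube_law_unit_cube)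
  also have "\<dots> = emeasure (cube_law a) ?B + emeasure (cube_law a) ?D"
    by (subst plus_emeasure) (auto intro!: arg_cong[where f="emeasure (cube_law a)"])
  finally have "emeasure mu ?B \<le> emeasure (cube_law a) ?B"
    using emeasure_finite[of ?D] by (simp add: add.commute[of _ "emeasure (cube_law a) ?D"] ennreal_add_left_cancel_le)
  moreover have "emeasure (cube_law a) ?B \<le> emeasure mu ?B"
    by (rule emeasure_cube_law_le) measurable
  moreover have "emeasure (cube_law a) A = emeasure (cube_law a) ?B"
  proof (rule emeasure_eq_AE)
    have "AE x in cube_law a. x \<in> unit_cube a"
      by (rule AE_I_eq_1) (auto simp: emeasure_cube_law_unit_cube)
    then show "AE x in cube_law a. x \<in> A \<longleftrightarrow> x \<in> ?B" by auto
  qed auto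
  ultimately show ?thesis by simp
qed

lemma cube_law_eq_density: "cube_law a = density mu (indicator (unit_cube a))"
proof (rule measure_eqI)
  fix A assume "A \<in> sets (cube_law a)"
  then have A: "A \<in> sets mu" by simp
  then show "emeasure (cube_law a) A = emeasure (density mu (indicator (unit_cube a))) A"
    by (subst emeasure_density) (auto simp: emeasure_cube_law indicator_inter_arith[symmetric] Int_commute)
qed simp

lemma nn_integral_unit_cube:
  assumes [measurable]: "f \<in> borel_measurable mu"
  shows "(\<integral>\<^sup>+x. indicator (unit_cube a) x * f x \<partial>mu) =
    (\<integral>\<^sup>+t. f (translate a (interval_to_cube t)) \<partial>uniform01)"
proof -
  have "(\<integral>\<^sup>+x. indicator (unit_cube a) x * f x \<partial>mu) = (\<integral>\<^sup>+x. f x \<partial>cube_law a)"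
    unfolding cube_law_eq_density by (subst nn_integral_density) auto
  also have "\<dots> = (\<integral>\<^sup>+t. f (translate a (interval_to_cube t)) \<partial>uniform01)"
    unfolding cube_law_def by (rule nn_integral_distr) measurable
  finally show ?thesis .
qed

section \<open>Lebesgue measure on the closed unit interval\<close>

text \<open>Completion does not change almost-everywhere statements, and the endpoint 1 is a null
  set.\<close>

lemma AE_lebesgue_on_unit_interval:
  "(AE t in lebesgue_on {0..1}. P t) \<longleftrightarrow> (AE t in uniform01. P t)"
proof -
  have "(AE t in lebesgue_on {0..1}. P t) \<longleftrightarrow> (AE t in lborel. t \<in> {0..1} \<longrightarrow> P t)"
    by (subst AE_restrict_space_iff) (auto simp: AE_completion_iff)
  also have "\<dots> \<longleftrightarrow> (AE t in lborel. t \<in> {0..<1} \<longrightarrow> P t)"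
  proof
    assume "AE t in lborel. t \<in> {0..<1} \<longrightarrow> P t"
    with AE_lborel_singleton[of "1::real"] show "AE t in lborel. t \<in> {0..1} \<longrightarrow> P t"
      by eventually_elim auto
  qed (auto elim: eventually_mono)
  finally show ?thesis by (simp only: AE_uniform01)
qed

lemma nn_integral_lebesgue_on_unit_interval:
  assumes "g \<in> borel_measurable borel"
  shows "(\<integral>\<^sup>+t. g t \<partial>lebesgue_on {0..1}) = (\<integral>\<^sup>+t. g t \<partial>uniform01)"
proof -
  have "(\<integral>\<^sup>+t. g t \<partial>lebesgue_on {0..1}) = (\<integral>\<^sup>+t. g t * indicator {0..1} t \<partial>lborel)"
    by (subst nn_integral_restrict_space) (auto simp: nn_integral_completion)
  also have "\<dots> = (\<integral>\<^sup>+t. indicator {0..<1} t * g t \<partial>lborel)"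
    using AE_lborel_singleton[of "1::real"]
    by (intro nn_integral_cong_AE) (auto elim!: eventually_mono simp: indicator_def)
  finally show ?thesis by (simp only: nn_integral_uniform01[OF assms])
qed

text \<open>A Lebesgue measurable component need not compose measurably with
  \<open>cube_to_interval\<close>; a Borel version does.\<close>

lemma borel_version_on_unit_interval:
  fixes F :: "real \<Rightarrow> real"
  assumes "F \<in> borel_measurable (lebesgue_on {0..1})"
  shows "\<exists>F'\<in>borel_measurable borel. AE t in lebesgue_on {0..1}. F' t = F t"
proof -
  have "(\<lambda>t. indicator {0..1} t *\<^sub>R F t) \<in> borel_measurable lebesgue"
    using assms by (subst (asm) borel_measurable_restrict_space_iff) auto
  then obtain F' where F': "F' \<in> borel_measurable lborel" "AE t in lborel. indicator {0..1} t *\<^sub>R F t = F' t"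
    using completion_ex_borel_measurable_real by blast
  have "AE t in lebesgue_on {0..1}. F' t = F t"
    using F'(2) by (subst AE_restrict_space_iff) (auto simp: AE_completion_iff elim!: eventually_mono)
  with F'(1) show ?thesis by auto
qed

section \<open>Unordered sums and the cardinality of the set of cubes\<close>

text \<open>The unordered sum is the supremum of its finite partial sums, and these are measures of
  finite unions. Along an enumeration of \<open>S\<close> the finite unions increase to the whole
  union.\<close>

lemma infsum_emeasure_disjoint:
  assumes S: "countable S" and disj: "disjoint_family_on A S" and meas: "\<And>i. i \<in> S \<Longrightarrow> A i \<in> sets M"
  shows "infsum (\<lambda>i. emeasure M (A i)) S = emeasure M (\<Union>i\<in>S. A i)"
proof (cases "S = {}")
  case False
  have fin: "(\<Sum>i\<in>J. emeasure M (A i)) = emeasure M (\<Union>i\<in>J. A i)" if "finite J" "J \<subseteq> S" for J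
    using that disj meas by (intro sum_emeasure) (auto intro: disjoint_family_on_mono)
  let ?J = "\<lambda>n. from_nat_into S ` {..n}"
  have J: "finite (?J n)" "?J n \<subseteq> S" for n
    using from_nat_into[OF False] by auto
  have "S = (\<Union>n. ?J n)"
    by (subst range_from_nat_into[OF False S, symmetric]) auto
  then have "(\<Union>i\<in>S. A i) = (\<Union>n. \<Union>i\<in>?J n. A i)"
    by (metis UN_UN_flatten)
  also have "emeasure M \<dots> = (SUP n. emeasure M (\<Union>i\<in>?J n. A i))"
    using meas J(2) by (intro SUP_emeasure_incseq[symmetric]) (auto simp: incseq_def intro!: sets.finite_UN bexI)
  also have "\<dots> = (SUP n. \<Sum>i\<in>?J n. emeasure M (A i))"
    using J by (simp only: fin)
  also have "\<dots> \<le> (SUP J\<in>{J. finite J \<and> J \<subseteq> S}. \<Sum>i\<in>J. emeasure M (A i))"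
    using J by (intro SUP_mono) auto
  also have "\<dots> = infsum (\<lambda>i. emeasure M (A i)) S"
    by (rule nonneg_infsum_complete[symmetric]) simp
  finally have "emeasure M (\<Union>i\<in>S. A i) \<le> infsum (\<lambda>i. emeasure M (A i)) S" .
  moreover have "infsum (\<lambda>i. emeasure M (A i)) S \<le> emeasure M (\<Union>i\<in>S. A i)"
  proof (subst nonneg_infsum_complete, simp, rule SUP_least)
    fix J assume "J \<in> {J. finite J \<and> J \<subseteq> S}"
    then show "(\<Sum>i\<in>J. emeasure M (A i)) \<le> emeasure M (\<Union>i\<in>S. A i)"
      using S meas by (auto simp: fin intro!: emeasure_mono sets.countable_UN')
  qed
  ultimately show ?thesis by simp
qed simp

text \<open>For each \<open>n\<close> only finitely many terms can reach \<open>1 / Suc n\<close>,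
  and every nonzero term reaches one of these thresholds.\<close>

lemma countable_support_infsum_ennreal:
  fixes g :: "'a \<Rightarrow> ennreal"
  assumes "infsum g UNIV < \<infinity>"
  shows "countable {i. g i \<noteq> 0}"
proof -
  have fin: "finite {i. ennreal (1 / Suc n) \<le> g i}" for n
  proof (rule ccontr)
    let ?S = "{i. ennreal (1 / Suc n) \<le> g i}"
    assume inf: "infinite ?S"
    have "infsum g ?S = \<infinity>"
      by (rule infsum_superconst_infinite_ennreal[OF _ _ inf, of "ennreal (1 / Suc n)"]) auto
    moreover have "infsum g ?S \<le> infsum g UNIV"
      by (rule infsum_mono_neutral) (auto intro: nonneg_summable_on_complete)
    ultimately show False using assms by simp
  qed
  have "{i. g i \<noteq> 0} = (\<Union>n. {i. ennreal (1 / Suc n) \<le> g i})"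
  proof (intro equalityI subsetI)
    fix i assume "i \<in> {i. g i \<noteq> 0}"
    then have "0 < g i" by (simp add: zero_less_iff_neq_zero)
    then obtain y where y: "0 < y" "y < g i"
      using dense by blast
    then obtain r where r: "0 < r" "ennreal r < g i"
      by (cases y) auto
    then obtain n where "1 / Suc n < r"
      using nat_approx_posE by blast
    then have "ennreal (1 / Suc n) \<le> g i"
      using r by (meson ennreal_leI less_imp_le order_trans)
    then show "i \<in> (\<Union>n. {i. ennreal (1 / Suc n) \<le> g i})" by auto
  next
    fix i assume "i \<in> (\<Union>n. {i. ennreal (1 / Suc n) \<le> g i})"
    then obtain n where n: "ennreal (1 / Suc n) \<le> g i" by auto
    have "0 < ennreal (1 / Suc n)" by simp
    with n show "i \<in> {i. g i \<noteq> 0}" by auto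
  qed
  with fin show ?thesis by (auto intro: countable_finite)
qed

text \<open>Both sets are equipotent with the power set of the naturals: integer sequences embed
  into it by their coded graphs, subsets embed back by their indicators, and the Schroeder-Bernstein
  theorem combines the two.\<close>

lemma ex_bij_real_int_seq: "\<exists>\<alpha> :: real \<Rightarrow> (nat \<Rightarrow> int). bij \<alpha>"
proof -
  have "inj (\<lambda>a :: nat \<Rightarrow> int. (\<lambda>n. prod_encode (n, int_encode (a n))) ` UNIV)"
  proof (rule injI, rule ext)
    fix a b :: "nat \<Rightarrow> int" and n
    assume eq: "(\<lambda>n. prod_encode (n, int_encode (a n))) ` UNIV = (\<lambda>n. prod_encode (n, int_encode (b n))) ` UNIV"
    have "prod_encode (n, int_encode (a n)) \<in> (\<lambda>n. prod_encode (n, int_encode (b n))) ` UNIV"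
      unfolding eq[symmetric] by auto
    then show "a n = b n" by (auto simp: int_encode_eq)
  qed
  then have 1: "(UNIV :: (nat \<Rightarrow> int) set) \<lesssim> (UNIV :: nat set set)"
    unfolding lepoll_def by blast
  have "inj (\<lambda>A :: nat set. (\<lambda>n. of_bool (n \<in> A)) :: nat \<Rightarrow> int)"
    by (rule injI) (auto simp: fun_eq_iff of_bool_def split: if_splits)
  then have 2: "(UNIV :: nat set set) \<lesssim> (UNIV :: (nat \<Rightarrow> int) set)"
    unfolding lepoll_def by blast
  have "(UNIV :: real set) \<approx> (UNIV :: nat set set)"
    using nat_sets_eqpoll_reals by (rule eqpoll_sym)
  also have "(UNIV :: nat set set) \<approx> (UNIV :: (nat \<Rightarrow> int) set)"
    using 1 2 lepoll_antisym by blast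
  finally show ?thesis by (auto simp: eqpoll_def)
qed

subsection \<open>The isometry\<close>

text \<open>The bijection \<alpha> labels the cubes by reals. Composition with a fixed map of points
  makes the operator linear at every point, not merely almost everywhere.\<close>

definition cube_coordinates :: "(real \<Rightarrow> nat \<Rightarrow> int) \<Rightarrow> ((nat \<Rightarrow> real) \<Rightarrow> real) \<Rightarrow> real \<Rightarrow> real \<Rightarrow> real" where
  "cube_coordinates \<alpha> f i t = f (translate (\<alpha> i) (interval_to_cube t))"

lemma measurable_cube_coordinates:
  assumes [measurable]: "f \<in> borel_measurable mu"
  shows "cube_coordinates \<alpha> f i \<in> borel_measurable borel"
  unfolding cube_coordinates_def by measurable

lemma borel_imp_measurable_lebesgue_on:
  "g \<in> borel_measurable borel \<Longrightarrow> g \<in> borel_measurable (lebesgue_on S)"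
  by (intro measurable_restrict_space1 measurable_completion) simp

lemma nn_integral_cube_coordinates:
  assumes [measurable]: "f \<in> borel_measurable mu"
  shows "(\<integral>\<^sup>+t. ennreal (\<bar>cube_coordinates \<alpha> f i t\<bar> powr p) \<partial>lebesgue_on {0..1}) =
    (\<integral>\<^sup>+x. indicator (unit_cube (\<alpha> i)) x * ennreal (\<bar>f x\<bar> powr p) \<partial>mu)"
proof -
  have [measurable]: "cube_coordinates \<alpha> f i \<in> borel_measurable borel"
    by (rule measurable_cube_coordinates) fact
  have "(\<integral>\<^sup>+x. indicator (unit_cube (\<alpha> i)) x * ennreal (\<bar>f x\<bar> powr p) \<partial>mu) =
      (\<integral>\<^sup>+t. ennreal (\<bar>cube_coordinates \<alpha> f i t\<bar> powr p) \<partial>uniform01)"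
    unfolding cube_coordinates_def by (rule nn_integral_unit_cube) measurable
  then show ?thesis
    by (subst nn_integral_lebesgue_on_unit_interval) auto
qed

text \<open>Component \<open>i\<close> carries the integral over the cube \<alpha> \<open>i\<close>.
  Cubes outside \<open>O_set p f\<close> contribute 0, and over \<open>O_set p f\<close> the sum is
  the full integral by the definition of \<open>Gp\<close>.\<close>

lemma normp_cube_coordinates:
  assumes \<alpha>: "bij \<alpha>" and f: "f \<in> Gp p"
  shows "lp_Lp01_normp p (cube_coordinates \<alpha> f) = (\<integral>\<^sup>+ x. ennreal (\<bar>f x\<bar> powr p) \<partial>mu)"
proof -
  let ?c = "\<lambda>a. \<integral>\<^sup>+ x. indicator (unit_cube a) x * ennreal (\<bar>f x\<bar> powr p) \<partial>mu"
  have meas: "f \<in> borel_measurable mu"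
    using f by (simp add: Gp_def Lp_mu_def)
  have "lp_Lp01_normp p (cube_coordinates \<alpha> f) = infsum (\<lambda>i. ?c (\<alpha> i)) UNIV"
    by (simp add: lp_Lp01_normp_def nn_integral_cube_coordinates[OF meas])
  also have "\<dots> = infsum ?c UNIV"
    using \<alpha> by (rule infsum_reindex_bij_betw)
  also have "\<dots> = infsum ?c (O_set p f)"
    by (rule infsum_cong_neutral) (auto simp: O_set_def)
  also have "\<dots> = (\<integral>\<^sup>+ x. ennreal (\<bar>f x\<bar> powr p) \<partial>mu)"
    using f by (simp add: Gp_def)
  finally show ?thesis .
qed

lemma cube_coordinates_in_lp:
  assumes \<alpha>: "bij \<alpha>" and f: "f \<in> Gp p"
  shows "cube_coordinates \<alpha> f \<in> lp_Lp01 p"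
proof -
  have "f \<in> borel_measurable mu" and fin: "(\<integral>\<^sup>+ x. ennreal (\<bar>f x\<bar> powr p) \<partial>mu) < \<infinity>"
    using f by (auto simp: Gp_def Lp_mu_def)
  then show ?thesis
    using normp_cube_coordinates[OF \<alpha> f]
    by (auto simp: lp_Lp01_def lp_Lp01_normp_def
        intro!: borel_imp_measurable_lebesgue_on measurable_cube_coordinates)
qed

text \<open>The preimage is glued from Borel versions of the components on the countably many cubes
  where the component is nonzero, and is 0 elsewhere.\<close>

lemma cube_coordinates_surj:
  assumes \<alpha>: "bij \<alpha>" and F: "F \<in> lp_Lp01 p"
  shows "\<exists>f\<in>Gp p. \<forall>i. AE t in lebesgue_on {0..1}. cube_coordinates \<alpha> f i t = F i t"
proof -
  let ?N = "\<lambda>i. \<integral>\<^sup>+ t. ennreal (\<bar>F i t\<bar> powr p) \<partial>lebesgue_on {0..1}"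
  have F_meas[measurable]: "F i \<in> borel_measurable (lebesgue_on {0..1})" for i
    using F by (simp add: lp_Lp01_def)
  have F_fin: "infsum ?N UNIV < \<infinity>"
    using F by (simp add: lp_Lp01_def)
  define S where "S = {i. ?N i \<noteq> 0}"
  have S: "countable S"
    unfolding S_def using F_fin by (rule countable_support_infsum_ennreal)
  have "\<exists>F'. F' \<in> borel_measurable borel \<and> (AE t in lebesgue_on {0..1}. F' t = F i t)" for i
    using borel_version_on_unit_interval[OF F_meas] by blast
  then obtain F' where F'[measurable]: "\<And>i. F' i \<in> borel_measurable borel"
      and F'_eq: "\<And>i. AE t in lebesgue_on {0..1}. F' i t = F i t"
    by metis
  \<comment> \<open>The floors of \<open>x\<close> determine its cube and the fractional parts its
    position there.\<close>
  define f where "f x = (let i = inv \<alpha> (\<lambda>n. \<lfloor>x n\<rfloor>) in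
      if i \<in> S then F' i (cube_to_interval (\<lambda>n. frac (x n))) else 0)" for x :: "nat \<Rightarrow> real"
  have inv: "inv \<alpha> (\<alpha> i) = i" "\<alpha> (inv \<alpha> a) = a" for i a
    using \<alpha> by (simp_all add: bij_is_inj bij_is_surj surj_f_inv_f)
  have f_cube: "f x = (if i \<in> S then F' i (cube_to_interval (\<lambda>n. frac (x n))) else 0)"
    if "x \<in> unit_cube (\<alpha> i)" for x i
    using that by (simp add: f_def mem_unit_cube_iff inv)
  let ?V = "\<Union>i\<in>S. unit_cube (\<alpha> i)"
  have f_outside: "f x = 0" if "x \<notin> ?V" for x
    using that by (auto simp: f_def Let_def mem_unit_cube_iff inv)
  have V[measurable]: "?V \<in> sets mu"
    using S by (intro sets.countable_UN') auto
  have f_meas[measurable]: "f \<in> borel_measurable mu"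
  \<comment> \<open>Countability of \<open>S\<close> makes this a countable partition, and on each
    piece \<open>f\<close> is 0 or given by one fixed \<open>F' i\<close>.\<close>
  proof (rule measurable_piecewise_restrict)
    show "countable (insert (UNIV - ?V) ((\<lambda>i. unit_cube (\<alpha> i)) ` S))"
      using S by simp
    show "space mu \<subseteq> \<Union> (insert (UNIV - ?V) ((\<lambda>i. unit_cube (\<alpha> i)) ` S))"
      by auto
    fix \<Omega> assume \<Omega>: "\<Omega> \<in> insert (UNIV - ?V) ((\<lambda>i. unit_cube (\<alpha> i)) ` S)"
    have "UNIV - ?V \<in> sets mu"
      using sets.compl_sets[OF V] by simp
    with \<Omega> show "\<Omega> \<inter> space mu \<in> sets mu" by auto
    have frac[measurable]: "(\<lambda>x n. frac (x n)) \<in> measurable mu (Pi\<^sub>M UNIV (\<lambda>_. borel :: real measure))"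
      unfolding frac_def by (rule measurable_PiM_single') auto
    consider "\<Omega> = UNIV - ?V" | i where "i \<in> S" "\<Omega> = unit_cube (\<alpha> i)"
      using \<Omega> by blast
    then show "f \<in> borel_measurable (restrict_space mu \<Omega>)"
    proof cases
      case 1
      then have "f x = 0" if "x \<in> space (restrict_space mu \<Omega>)" for x
        using that f_outside by (simp add: space_restrict_space)
      then show ?thesis by (simp cong: measurable_cong)
    next
      case (2 i)
      then have "f x = F' i (cube_to_interval (\<lambda>n. frac (x n)))" if "x \<in> space (restrict_space mu \<Omega>)" for x
        using that f_cube by (simp add: space_restrict_space)
      moreover have "(\<lambda>x. F' i (cube_to_interval (\<lambda>n. frac (x n)))) \<in> borel_measurable (restrict_space mu \<Omega>)"
        by (rule measurable_restrict_space1) measurable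
      ultimately show ?thesis by (simp cong: measurable_cong)
    qed
  qed
  have coords: "AE t in lebesgue_on {0..1}. cube_coordinates \<alpha> f i t = F i t" for i
  proof (cases "i \<in> S")
    case True
    have "cube_coordinates \<alpha> f i t = F' i (cube_to_interval (interval_to_cube t))" for t
      unfolding cube_coordinates_def using True
      by (subst f_cube[of _ i])
        (simp_all add: mem_unit_cube_iff floor_translate_interval_to_cube frac_translate_interval_to_cube)
    moreover have "AE t in lebesgue_on {0..1}. cube_to_interval (interval_to_cube t) = t"
      unfolding AE_lebesgue_on_unit_interval by (rule AE_cube_to_interval_to_cube)
    ultimately show ?thesis
      using F'_eq[of i] by (auto elim!: eventually_elim2)
  next
    case False
    have "cube_coordinates \<alpha> f i t = 0" for t
      unfolding cube_coordinates_def using False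
      by (subst f_cube[of _ i]) (simp_all add: mem_unit_cube_iff floor_translate_interval_to_cube)
    \<comment> \<open>Outside \<open>S\<close> the integral of the \<open>p\<close>-th power
      vanishes, so \<open>F i\<close> is itself 0 almost everywhere.\<close>
    moreover have "AE t in lebesgue_on {0..1}. ennreal (\<bar>F i t\<bar> powr p) = 0"
      using False by (subst nn_integral_0_iff_AE[symmetric]) (auto simp: S_def)
    ultimately show ?thesis
      by (auto elim!: eventually_mono simp: ennreal_eq_0_iff)
  qed
  let ?c = "\<lambda>a. \<integral>\<^sup>+ x. indicator (unit_cube a) x * ennreal (\<bar>f x\<bar> powr p) \<partial>mu"
  have c: "?c (\<alpha> i) = ?N i" for i
  proof -
    have "?c (\<alpha> i) = (\<integral>\<^sup>+t. ennreal (\<bar>cube_coordinates \<alpha> f i t\<bar> powr p) \<partial>lebesgue_on {0..1})"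
      by (rule nn_integral_cube_coordinates[symmetric]) fact
    also have "\<dots> = ?N i"
      using coords[of i] by (intro nn_integral_cong_AE) (auto elim!: eventually_mono)
    finally show ?thesis .
  qed
  have O: "O_set p f = \<alpha> ` S"
  proof -
    have "O_set p f = {a. ?N (inv \<alpha> a) \<noteq> 0}"
      unfolding O_set_def c[symmetric] inv ..
    then show ?thesis
      unfolding S_def bij_image_Collect_eq[OF \<alpha>] .
  qed
  then have V_eq: "F_set p f = ?V" by (simp add: F_set_def)
  have int_V: "(\<integral>\<^sup>+ x. ennreal (\<bar>f x\<bar> powr p) \<partial>mu) =
      (\<integral>\<^sup>+ x. indicator (F_set p f) x * ennreal (\<bar>f x\<bar> powr p) \<partial>mu)"
    unfolding V_eq using f_outside by (intro nn_integral_cong) (auto split: split_indicator)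
  \<comment> \<open>Under this density the cube integrals become measures of disjoint sets, so
    countable additivity turns their sum into the integral over \<open>F_set p f\<close>.\<close>
  let ?D = "density mu (\<lambda>x. ennreal (\<bar>f x\<bar> powr p))"
  have D: "emeasure ?D A = (\<integral>\<^sup>+ x. indicator A x * ennreal (\<bar>f x\<bar> powr p) \<partial>mu)" if "A \<in> sets mu" for A
    using that by (subst emeasure_density) (auto simp: mult.commute)
  have "disjoint_family_on unit_cube (\<alpha> ` S)"
    by (auto simp: disjoint_family_on_def mem_unit_cube_iff)
  then have "infsum (\<lambda>a. emeasure ?D (unit_cube a)) (\<alpha> ` S) = emeasure ?D (\<Union>a\<in>\<alpha> ` S. unit_cube a)"
    using S by (intro infsum_emeasure_disjoint) auto
  then have sum_V: "infsum ?c (O_set p f) = (\<integral>\<^sup>+ x. indicator (F_set p f) x * ennreal (\<bar>f x\<bar> powr p) \<partial>mu)"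
    unfolding O V_eq by (simp add: D)
  have "infsum ?c (O_set p f) = infsum (\<lambda>i. ?c (\<alpha> i)) S"
    unfolding O using \<alpha> by (subst infsum_reindex) (auto simp: comp_def intro: inj_on_subset bij_is_inj)
  also have "\<dots> = infsum ?N UNIV"
    unfolding c by (rule infsum_cong_neutral) (auto simp: S_def)
  finally have "f \<in> Gp p"
    using F_fin int_V sum_V by (simp add: Gp_def Lp_mu_def)
  with coords show ?thesis by blast
qed

theorem theorem3p4:
  fixes p :: real
  assumes "1 \<le> p"
  shows "\<exists>T :: ((nat \<Rightarrow> real) \<Rightarrow> real) \<Rightarrow> (real \<Rightarrow> real \<Rightarrow> real).
     (\<forall>f\<in>Gp p. T f \<in> lp_Lp01 p)
   \<and> (\<forall>f\<in>Gp p. \<forall>g\<in>Gp p. \<forall>a b :: real.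
        T (\<lambda>x. a * f x + b * g x) = (\<lambda>i t. a * T f i t + b * T g i t))
   \<and> (\<forall>f\<in>Gp p. lp_Lp01_normp p (T f) = (\<integral>\<^sup>+ x. ennreal (\<bar>f x\<bar> powr p) \<partial>mu))
   \<and> (\<forall>F\<in>lp_Lp01 p. \<exists>f\<in>Gp p. \<forall>i. AE t in lebesgue_on {0..1}. T f i t = F i t)"
proof -
  obtain \<alpha> :: "real \<Rightarrow> nat \<Rightarrow> int" where \<alpha>: "bij \<alpha>"
    using ex_bij_real_int_seq by blast
  have linear: "cube_coordinates \<alpha> (\<lambda>x. a * f x + b * g x) =
      (\<lambda>i t. a * cube_coordinates \<alpha> f i t + b * cube_coordinates \<alpha> g i t)" for a b f g
    by (simp add: cube_coordinates_def fun_eq_iff)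
  show ?thesis
    using cube_coordinates_in_lp[OF \<alpha>] linear normp_cube_coordinates[OF \<alpha>] cube_coordinates_surj[OF \<alpha>]
    by (intro exI[of _ "cube_coordinates \<alpha>"]) simp
qed

end
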